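(* Let $T\subset\mathbb{R}^2$ be a triangle and let $\mathcal{P}=\{P_i : i\in I\}$ be a locally finite collection of homothetic copies of $T$ that is a $12$-fold covering of the whole plane $\mathbb{R}^2$. Then $\mathcal{P}$ is decomposable into two coverings, i.e. there is a partition $I=I_1\sqcup I_2$ such that each of $\{P_i : i\in I_1\}$ and $\{P_i: i\in I_2\}$ is a covering of $\mathbb{R}^2$.
   Context: A triangle is a nondegenerate triangular region in the plane: the convex hull of three non-collinear points (closed triangle) or its interior (open triangle). A homothetic copy of $T$ is a set $\lambda T+v$ with $\lambda>0$ and $v\in\mathbb{R}^2$. A collection $\{P_i : i\in I\}$ of sets is an $m$-fold covering of a set $S$ if every point of $S$ is contained in at least $m$ members of the collection (i.e. in $P_i$ for at least $m$ indices $i$); a $1$-fold covering is called a covering. The collection is locally finite if every compact set intersects only finitely many of its members (i.e. $P_i$ for only finitely many indices $i$). *)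

theory Defs
  imports "HOL-Analysis.Analysis"
begin

definition is_triangle :: "(real^2) set \<Rightarrow> bool" where
  "is_triangle T \<longleftrightarrow>
     (\<exists>a b c. \<not> collinear {a, b, c} \<and>
        (T = convex hull {a, b, c} \<or> T = interior (convex hull {a, b, c})))"

definition homothetic_copy :: "'a::real_vector set \<Rightarrow> 'a set \<Rightarrow> bool" where
  "homothetic_copy T Q \<longleftrightarrow> (\<exists>l>0. \<exists>v. Q = (\<lambda>x. l *\<^sub>R x + v) ` T)"

(* Members are counted by index, so repeated sets count with multiplicity. A witnessing
   m-element index set is used because card is 0 on infinite sets. *)
definition fold_covering :: "nat \<Rightarrow> 'i set \<Rightarrow> ('i \<Rightarrow> 'a set) \<Rightarrow> 'a set \<Rightarrow> bool" where
  "fold_covering m I P S \<longleftrightarrow>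
     (\<forall>x\<in>S. \<exists>J\<subseteq>I. finite J \<and> card J = m \<and> (\<forall>i\<in>J. x \<in> P i))"

definition covering :: "'i set \<Rightarrow> ('i \<Rightarrow> 'a set) \<Rightarrow> 'a set \<Rightarrow> bool" where
  "covering I P S \<longleftrightarrow> fold_covering 1 I P S"

definition locally_finite_family :: "'i set \<Rightarrow> ('i \<Rightarrow> 'a::topological_space set) \<Rightarrow> bool" where
  "locally_finite_family I P \<longleftrightarrow> (\<forall>K. compact K \<longrightarrow> finite {i \<in> I. P i \<inter> K \<noteq> {}})"

end

theory Submission
  imports Defs
begin

text \<open>
  Homothetic triangles containing a point of the plane are described by three linear
  inequalities, so colouring triangles becomes colouring points of three-space such that every
  octant with twelve points has both colours; a compactness argument reduces to finitely many
  points. The third coordinate is read as time: points of the plane arrive one by one, and a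
  forest of edges (pairs that will get different colours) is grown so that at every moment each
  quadrant with twelve points contains an edge. Call a point good if its own quadrant contains
  an edge. The other points are either stairs, any three of which in a quadrant force an edge,
  or lie below the staircase, and a quadrant without stairs has at most three points below. When four points
  \<open>p1, p2, p3, p4\<close> below the staircase share a quadrant without stairs, the edges \<open>p1 p2\<close> and
  \<open>p3 p4\<close> are added and \<open>p2, p3\<close> become stairs. An edge-free quadrant thus has at most two stairs
  and three stair-free pieces, i.e. at most 2 + 3 * 3 = 11 points. No cycles arise since every
  component of the forest contains at most one point below the staircase (Keszegh and Palvolgyi).
\<close>

section \<open>Quadrants and antichains of points\<close>

definition wedge :: "('a \<Rightarrow> real) \<Rightarrow> ('a \<Rightarrow> real) \<Rightarrow> real \<Rightarrow> real \<Rightarrow> 'a set" where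
  "wedge f g X Y = {q. f q \<le> X \<and> g q \<le> Y}"

definition has_edge :: "('a \<times> 'a) set \<Rightarrow> 'a set \<Rightarrow> bool" where
  "has_edge E U \<longleftrightarrow> (\<exists>u\<in>U. \<exists>v\<in>U. (u, v) \<in> E)"

lemma has_edge_mono: "has_edge E U \<Longrightarrow> E \<subseteq> E' \<Longrightarrow> U \<subseteq> U' \<Longrightarrow> has_edge E' U'"
  unfolding has_edge_def by blast

text \<open>An antichain for the coordinatewise order. The comparison is weak, so distinct members
  differ in both coordinates; this settles ties and repeated points.\<close>

definition incomparable :: "('a \<Rightarrow> real) \<Rightarrow> ('a \<Rightarrow> real) \<Rightarrow> 'a set \<Rightarrow> bool" where
  "incomparable f g A \<longleftrightarrow> (\<forall>a\<in>A. \<forall>b\<in>A. a \<in> wedge f g (f b) (g b) \<longrightarrow> a = b)"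

lemma incomparable_iff:
  assumes "incomparable f g A" "a \<in> A" "b \<in> A"
  shows "f a < f b \<longleftrightarrow> g b < g a"
  using assms unfolding incomparable_def wedge_def by (smt (verit) mem_Collect_eq)

lemma incomparable_eq:
  assumes "incomparable f g A" "a \<in> A" "b \<in> A" "f a = f b"
  shows "a = b"
  using assms unfolding incomparable_def wedge_def by (metis (mono_tags, lifting) linorder_linear mem_Collect_eq order_refl)

text \<open>When \<open>B\<close> is an antichain, \<open>wedge f g (f p4) (g p1)\<close> is the
  least quadrant containing all four points. Saturation thus means that no four points of
  \<open>B\<close> admit the move that adds \<open>p1 p2\<close> and \<open>p3 p4\<close>.\<close>

definition saturated :: "('a \<Rightarrow> real) \<Rightarrow> ('a \<Rightarrow> real) \<Rightarrow> 'a set \<Rightarrow> 'a set \<Rightarrow> bool" where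
  "saturated f g S B \<longleftrightarrow>
     (\<forall>p1\<in>B. \<forall>p2\<in>B. \<forall>p3\<in>B. \<forall>p4\<in>B. f p1 < f p2 \<and> f p2 < f p3 \<and> f p3 < f p4 \<longrightarrow>
        S \<inter> wedge f g (f p4) (g p1) \<noteq> {})"

text \<open>
  \<open>P\<close> are the points, \<open>E\<close> the edges, \<open>S\<close> the stairs and \<open>B\<close> the points below the staircase.
  The last assumption says, without mentioning components, that \<open>E\<close> is bipartite and no
  component of \<open>E\<close> has two points of \<open>B\<close>.
\<close>

locale staircase =
  fixes f g :: "'a \<Rightarrow> real" and P :: "'a set" and E :: "('a \<times> 'a) set" and S B :: "'a set"
  assumes finite_points: "finite P" and stairs_subset: "S \<subseteq> P" and below_subset: "B \<subseteq> P" and edges_subset: "E \<subseteq> P \<times> P"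
    and covered: "\<And>q. q \<in> P \<Longrightarrow> q \<in> S \<or> q \<in> B \<or> has_edge E (wedge f g (f q) (g q))"
    and stairs_incomparable: "incomparable f g S" and below_incomparable: "incomparable f g B"
    and stair_not_le_below: "\<And>s b. s \<in> S \<Longrightarrow> b \<in> B \<Longrightarrow> s \<notin> wedge f g (f b) (g b)"
    and three_stairs: "\<And>X Y s1 s2 s3. \<lbrakk>s1 \<in> S \<inter> wedge f g X Y; s2 \<in> S \<inter> wedge f g X Y; s3 \<in> S \<inter> wedge f g X Y;
        s1 \<noteq> s2; s1 \<noteq> s3; s2 \<noteq> s3\<rbrakk> \<Longrightarrow> has_edge E (wedge f g X Y)"
    and colouring_extends: "\<And>\<beta>::'a \<Rightarrow> bool. \<exists>\<kappa>. (\<forall>b\<in>B. \<kappa> b = \<beta> b) \<and> (\<forall>(u, v)\<in>E. \<kappa> u \<noteq> \<kappa> v)"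

section \<open>Moves that preserve the staircase invariant\<close>

text \<open>A stair with \<open>p2\<close> or \<open>p3\<close> in its quadrant is dropped. It lies
  outside the quadrant of the four points, so it is higher than \<open>p1\<close> or further right
  than \<open>p4\<close>, and its own quadrant contains both ends of a new edge. Every old stair
  that is kept is left of \<open>p2\<close> and above \<open>p1\<close>, or right of
  \<open>p4\<close> and below \<open>p3\<close>.\<close>

lemma (in staircase) step:
  assumes p: "p1 \<in> B" "p2 \<in> B" "p3 \<in> B" "p4 \<in> B"
    and lt: "f p1 < f p2" "f p2 < f p3" "f p3 < f p4"
    and empty: "S \<inter> wedge f g (f p4) (g p1) = {}"
  defines "E' \<equiv> insert (p1, p2) (insert (p3, p4) E)"
    and "S' \<equiv> insert p2 (insert p3 {s \<in> S. p2 \<notin> wedge f g (f s) (g s) \<and> p3 \<notin> wedge f g (f s) (g s)})"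
  shows "staircase f g P E' S' (B - {p2, p3})"
proof -
  have gt: "g p2 < g p1" "g p3 < g p2" "g p4 < g p3"
    using incomparable_iff[OF below_incomparable] p lt by blast+
  have E12: "has_edge E' U" if "p1 \<in> U" "p2 \<in> U" for U
    using that by (auto simp: E'_def has_edge_def)
  have E34: "has_edge E' U" if "p3 \<in> U" "p4 \<in> U" for U
    using that by (auto simp: E'_def has_edge_def)
  have EE: "E \<subseteq> E'" by (auto simp: E'_def)
  have out: "f p4 < f s \<or> g p1 < g s" if "s \<in> S" for s
    using that empty by (force simp: wedge_def)
  have cov': "q \<in> S' \<or> q \<in> B - {p2,p3} \<or> has_edge E' (wedge f g (f q) (g q))" if q: "q \<in> P" for q
  proof (cases "q \<in> S \<and> q \<notin> S'")
    case True
    then have ge: "(f p2 \<le> f q \<and> g p2 \<le> g q) \<or> (f p3 \<le> f q \<and> g p3 \<le> g q)"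
      by (auto simp: S'_def wedge_def)
    show ?thesis
      using out[of q] True ge lt gt E12[of "wedge f g (f q) (g q)"] E34[of "wedge f g (f q) (g q)"]
      unfolding wedge_def by force
  next
    case False
    then show ?thesis using covered[OF q] has_edge_mono[OF _ EE subset_refl] by (auto simp: S'_def)
  qed
  have aS': "incomparable f g S'"
  proof -
    have "a = b" if a: "a \<in> S'" and b: "b \<in> S'" and ab: "a \<in> wedge f g (f b) (g b)" for a b
    proof -
      consider "a \<in> S" "b \<in> S" | "a \<in> {p2,p3}" "b \<in> {p2,p3}" | "a \<in> {p2,p3}" "b \<in> S'" "b \<notin> {p2,p3}"
        | "a \<in> S" "b \<in> {p2,p3}"
        using a b by (auto simp: S'_def)
      then show ?thesis
      proof cases
        case 1 then show ?thesis using stairs_incomparable ab unfolding incomparable_def by blast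
      next
        case 2 then show ?thesis using below_incomparable ab p unfolding incomparable_def by blast
      next
        case 3 then show ?thesis using ab by (auto simp: S'_def)
      next
        case 4 then show ?thesis using stair_not_le_below ab p by blast
      qed
    qed
    then show ?thesis unfolding incomparable_def by blast
  qed
  have SB': "s \<notin> wedge f g (f b) (g b)" if "s \<in> S'" "b \<in> B - {p2,p3}" for s b
    using that stair_not_le_below below_incomparable p unfolding S'_def incomparable_def by blast
  \<comment> \<open>A quadrant with a new stair and a kept old one contains a whole new edge:
    \<open>p1 p2\<close> if the old one is on the upper left, \<open>p3 p4\<close> if it is on the
    lower right.\<close>
  have new_old: "has_edge E' (wedge f g X Y)"
    if n: "n \<in> {p2,p3}" "n \<in> wedge f g X Y" and k: "k \<in> S' - {p2,p3}" "k \<in> wedge f g X Y" for n k X Y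
  proof -
    have kS: "k \<in> S" and nle: "\<not> (f p2 \<le> f k \<and> g p2 \<le> g k)" "\<not> (f p3 \<le> f k \<and> g p3 \<le> g k)"
      using k by (auto simp: S'_def wedge_def)
    consider "f k < f p2" "g p1 < g k" | "f p4 < f k" "g k < g p3"
      using out[OF kS] nle lt gt by linarith
    then show ?thesis
    proof cases
      case 1
      then have "p1 \<in> wedge f g X Y" "p2 \<in> wedge f g X Y"
        using n k lt gt by (auto simp: wedge_def)
      then show ?thesis by (rule E12)
    next
      case 2
      then have "p3 \<in> wedge f g X Y" "p4 \<in> wedge f g X Y"
        using n k lt gt by (auto simp: wedge_def)
      then show ?thesis by (rule E34)
    qed
  qed
  have three': "has_edge E' (wedge f g X Y)"
    if s: "s1\<in>S' \<inter> wedge f g X Y" "s2\<in>S' \<inter> wedge f g X Y" "s3\<in>S' \<inter> wedge f g X Y"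
        "s1 \<noteq> s2" "s1 \<noteq> s3" "s2 \<noteq> s3" for X Y s1 s2 s3
  proof (cases "{s1,s2,s3} \<inter> {p2,p3} = {}")
    case True
    then have "s1 \<in> S" "s2 \<in> S" "s3 \<in> S" using s by (auto simp: S'_def)
    then show ?thesis using three_stairs[of s1 X Y s2 s3] s has_edge_mono[OF _ EE subset_refl] by blast
  next
    case False
    then obtain n where n: "n \<in> {s1,s2,s3}" "n \<in> {p2,p3}" by blast
    have "\<not> {s1,s2,s3} \<subseteq> {p2,p3}" using s(4-6) by auto
    then obtain k where k: "k \<in> {s1,s2,s3}" "k \<notin> {p2,p3}" by blast
    show ?thesis using new_old[of n X Y k] n k s(1-3) by blast
  qed
  have ext': "\<exists>\<kappa>. (\<forall>b\<in>B - {p2,p3}. \<kappa> b = \<beta> b) \<and> (\<forall>(u, v)\<in>E'. \<kappa> u \<noteq> \<kappa> v)" for \<beta> :: "'a \<Rightarrow> bool"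
  proof -
    have d: "p1 \<noteq> p2" "p1 \<noteq> p3" "p2 \<noteq> p3" "p2 \<noteq> p4" "p3 \<noteq> p4" using lt by auto
    \<comment> \<open>\<open>p1\<close> and \<open>p4\<close> stay in \<open>B\<close> and keep
      their prescribed colours; \<open>p2\<close> and \<open>p3\<close> leave \<open>B\<close>, so
      their colours can be chosen opposite to these.\<close>
    obtain \<kappa> where c: "\<forall>b\<in>B. \<kappa> b = (\<beta>(p2 := \<not> \<beta> p1, p3 := \<not> \<beta> p4)) b" "\<forall>(u, v)\<in>E. \<kappa> u \<noteq> \<kappa> v"
      using colouring_extends by blast
    show ?thesis
      by (rule exI[of _ \<kappa>]) (use c p d in \<open>auto simp: E'_def\<close>)
  qed
  have sub: "S' \<subseteq> P" "B - {p2,p3} \<subseteq> P" "E' \<subseteq> P \<times> P"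
    using stairs_subset below_subset edges_subset p by (auto simp: S'_def E'_def)
  have aB': "incomparable f g (B - {p2,p3})"
    using below_incomparable unfolding incomparable_def by blast
  show ?thesis
    by (rule staircase.intro[OF finite_points sub cov' aS' aB' SB' three' ext'])
qed

text \<open>Each \<open>step\<close> takes two points out of the finite set \<open>B\<close>, so
  repetition ends in a saturated state on the same points.\<close>

lemma staircase_saturate:
  fixes f g :: "'a \<Rightarrow> real"
  assumes "staircase f g P E S B"
  shows "\<exists>E' S' B'. E \<subseteq> E' \<and> staircase f g P E' S' B' \<and> saturated f g S' B'"
  using assms
proof (induction "card B" arbitrary: E S B rule: less_induct)
  case less
  have finite_points: "finite B" using staircase.finite_points[OF less.prems] staircase.below_subset[OF less.prems] finite_subset by blast
  show ?case
  proof (cases "saturated f g S B")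
    case True
    then show ?thesis using less.prems by blast
  next
    case False
    then obtain p1 p2 p3 p4 where p: "p1 \<in> B" "p2 \<in> B" "p3 \<in> B" "p4 \<in> B"
      and lt: "f p1 < f p2" "f p2 < f p3" "f p3 < f p4"
      and emp: "S \<inter> wedge f g (f p4) (g p1) = {}"
      unfolding saturated_def by blast
    note step = staircase.step[OF less.prems p lt emp]
    have "card (B - {p2,p3}) < card B"
      using p finite_points by (intro psubset_card_mono) auto
    from less.hyps[OF this step] show ?thesis by blast
  qed
qed

text \<open>If the quadrant of the newcomer \<open>p\<close> holds a stair or a point of
  \<open>B\<close>, one edge to it makes \<open>p\<close> good. Otherwise \<open>p\<close> joins
  \<open>B\<close>, and the points of \<open>B\<close> weakly above \<open>p\<close> leave it, made
  good by edges to \<open>p\<close>.\<close>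

lemma (in staircase) insert:
  assumes new: "p \<notin> P"
  shows "\<exists>E' S' B'. E \<subseteq> E' \<and> staircase f g (insert p P) E' S' B'"
proof -
  have fresh: "p \<notin> S" "p \<notin> B" "\<And>u. (u, p) \<notin> E" "\<And>v. (p, v) \<notin> E"
    using new stairs_subset below_subset edges_subset by blast+
  show ?thesis
  proof (cases "(S \<union> B) \<inter> wedge f g (f p) (g p) = {}")
    case False
    then obtain x where x: "x \<in> S \<union> B" "x \<in> wedge f g (f p) (g p)" by blast
    let ?E = "insert (p, x) E"
    have pp: "has_edge ?E (wedge f g (f p) (g p))"
      using x by (auto simp: has_edge_def wedge_def)
    have mono: "has_edge ?E U" if "has_edge E U" for U
      using that by (rule has_edge_mono) auto
    have ext': "\<exists>\<kappa>. (\<forall>b\<in>B. \<kappa> b = \<beta> b) \<and> (\<forall>(u, v)\<in>?E. \<kappa> u \<noteq> \<kappa> v)" for \<beta> :: "'a \<Rightarrow> bool"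
    proof -
      obtain \<kappa> where c: "\<forall>b\<in>B. \<kappa> b = \<beta> b" "\<forall>(u, v)\<in>E. \<kappa> u \<noteq> \<kappa> v"
        using colouring_extends by blast
      \<comment> \<open>\<open>p\<close> is on no old edge, so it hangs from \<open>x\<close> as a
        leaf and can be recoloured freely.\<close>
      show ?thesis
        by (rule exI[of _ "\<kappa>(p := \<not> \<kappa> x)"]) (use c x fresh in auto)
    qed
    have "staircase f g (insert p P) ?E S B"
    proof
      show "q \<in> S \<or> q \<in> B \<or> has_edge ?E (wedge f g (f q) (g q))" if "q \<in> insert p P" for q
        using that covered pp mono by blast
      show "has_edge ?E (wedge f g X Y)"
        if "s1 \<in> S \<inter> wedge f g X Y" "s2 \<in> S \<inter> wedge f g X Y" "s3 \<in> S \<inter> wedge f g X Y"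
          "s1 \<noteq> s2" "s1 \<noteq> s3" "s2 \<noteq> s3" for X Y s1 s2 s3
        using three_stairs[OF that] by (rule mono)
    qed (use finite_points stairs_subset below_subset edges_subset x stairs_incomparable below_incomparable stair_not_le_below ext' in auto)
    then show ?thesis by blast
  next
    case True
    define D where "D = {b \<in> B. p \<in> wedge f g (f b) (g b)}"
    let ?E = "E \<union> {p} \<times> D" and ?B = "insert p (B - D)"
    have mono: "has_edge ?E U" if "has_edge E U" for U
      using that by (rule has_edge_mono) auto
    have DD: "has_edge ?E (wedge f g (f q) (g q))" if "q \<in> D" for q
      using that by (auto simp: has_edge_def D_def wedge_def)
    have ext': "\<exists>\<kappa>. (\<forall>b\<in>?B. \<kappa> b = \<beta> b) \<and> (\<forall>(u, v)\<in>?E. \<kappa> u \<noteq> \<kappa> v)" for \<beta> :: "'a \<Rightarrow> bool"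
    proof -
      \<comment> \<open>The colours on \<open>D\<close> can still be prescribed, as \<open>D\<close>
        is part of the old \<open>B\<close>: all of \<open>D\<close> gets the opposite of the colour
        wanted for \<open>p\<close>.\<close>
      obtain \<kappa> where c: "\<forall>b\<in>B. \<kappa> b = (if b \<in> D then \<not> \<beta> p else \<beta> b)" "\<forall>(u, v)\<in>E. \<kappa> u \<noteq> \<kappa> v"
        using colouring_extends[of "\<lambda>b. if b \<in> D then \<not> \<beta> p else \<beta> b"] by blast
      have "D \<subseteq> B" by (auto simp: D_def)
      then show ?thesis
        by (intro exI[of _ "\<kappa>(p := \<beta> p)"]) (use c fresh in auto)
    qed
    have "staircase f g (insert p P) ?E S ?B"
    proof
      show "q \<in> S \<or> q \<in> ?B \<or> has_edge ?E (wedge f g (f q) (g q))" if "q \<in> insert p P" for q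
        using that covered DD mono by blast
      show "has_edge ?E (wedge f g X Y)"
        if "s1 \<in> S \<inter> wedge f g X Y" "s2 \<in> S \<inter> wedge f g X Y" "s3 \<in> S \<inter> wedge f g X Y"
          "s1 \<noteq> s2" "s1 \<noteq> s3" "s2 \<noteq> s3" for X Y s1 s2 s3
        using three_stairs[OF that] by (rule mono)
      show "incomparable f g ?B"
        using below_incomparable True unfolding incomparable_def D_def by blast
      show "s \<notin> wedge f g (f b) (g b)" if "s \<in> S" "b \<in> ?B" for s b
        using that stair_not_le_below True by blast
    qed (use finite_points stairs_subset below_subset edges_subset stairs_incomparable ext' in \<open>auto simp: D_def\<close>)
    then show ?thesis by blast
  qed
qed

section \<open>Counting the points of an edge-free quadrant\<close>

lemma obtain_four_increasing:
  fixes f :: "'a \<Rightarrow> real"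
  assumes "finite A" "inj_on f A" "4 \<le> card A"
  obtains p1 p2 p3 p4 where "p1 \<in> A" "p2 \<in> A" "p3 \<in> A" "p4 \<in> A" "f p1 < f p2" "f p2 < f p3" "f p3 < f p4"
proof -
  define l where "l = sorted_list_of_set (f ` A)"
  have len: "length l = card A" using assms by (simp add: l_def card_image)
  have set: "set l = f ` A" using assms by (simp add: l_def)
  have sl: "sorted_wrt (<) l" by (simp add: l_def)
  have m: "\<exists>p\<in>A. f p = l ! n" if "n < 4" for n
  proof -
    have "l ! n \<in> set l" using that assms len by simp
    then show ?thesis using set by auto
  qed
  obtain p1 where 1: "p1 \<in> A" "f p1 = l ! 0" using m[of 0] by auto
  obtain p2 where 2: "p2 \<in> A" "f p2 = l ! 1" using m[of 1] by auto
  obtain p3 where 3: "p3 \<in> A" "f p3 = l ! 2" using m[of 2] by auto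
  obtain p4 where 4: "p4 \<in> A" "f p4 = l ! 3" using m[of 3] by auto
  have s: "l ! i < l ! j" if "i < j" "j < 4" for i j
    using sorted_wrt_nth_less[OF sl, of i j] that assms len by simp
  show thesis using that[OF 1(1) 2(1) 3(1) 4(1)] 1 2 3 4 s[of 0 1] s[of 1 2] s[of 2 3] by simp
qed

text \<open>No good point lies in an edge-free quadrant, so only stairs and points of
  \<open>B\<close> count. No point of \<open>B\<close> is weakly above a stair in both coordinates;
  hence zero, one or two stairs divide the points of \<open>B\<close> into one, two or three pieces,
  each of at most three points by saturation.\<close>

lemma (in staircase) wedge_bound:
  assumes sat: "saturated f g S B"
    and noedge: "\<not> has_edge E (wedge f g X Y)"
  shows "card (P \<inter> wedge f g X Y) \<le> 11"
proof -
  have finS: "finite S" and finB: "finite B" using finite_points stairs_subset below_subset finite_subset by auto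
  have PW: "P \<inter> wedge f g X Y \<subseteq> (S \<inter> wedge f g X Y) \<union> (B \<inter> wedge f g X Y)"
  proof
    fix q assume q: "q \<in> P \<inter> wedge f g X Y"
    then have "wedge f g (f q) (g q) \<subseteq> wedge f g X Y" by (auto simp: wedge_def)
    then have "\<not> has_edge E (wedge f g (f q) (g q))"
      using noedge has_edge_mono[OF _ subset_refl] by blast
    then show "q \<in> (S \<inter> wedge f g X Y) \<union> (B \<inter> wedge f g X Y)" using covered q by blast
  qed
  \<comment> \<open>The condition \<open>no\<close> keeps stairs out of every quadrant whose corner
    takes its coordinates from \<open>A\<close>; by saturation four points of \<open>A\<close> would
    force a stair into one.\<close>
  have small: "card A \<le> 3"
    if A: "A \<subseteq> B" and no: "\<And>z a b. \<lbrakk>z \<in> S; a \<in> A; b \<in> A; f z \<le> f a; g z \<le> g b\<rbrakk> \<Longrightarrow> False" for A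
  proof (rule ccontr)
    assume "\<not> card A \<le> 3"
    then have "4 \<le> card A" by simp
    moreover have "finite A" using A finB finite_subset by auto
    moreover have "inj_on f A" using A incomparable_eq[OF below_incomparable] by (auto simp: inj_on_def)
    ultimately obtain p1 p2 p3 p4 where p: "p1 \<in> A" "p2 \<in> A" "p3 \<in> A" "p4 \<in> A"
      and lt: "f p1 < f p2" "f p2 < f p3" "f p3 < f p4"
      by (metis obtain_four_increasing)
    have "S \<inter> wedge f g (f p4) (g p1) \<noteq> {}"
      using sat p A lt unfolding saturated_def by blast
    then obtain z where "z \<in> S" "f z \<le> f p4" "g z \<le> g p1" by (auto simp: wedge_def)
    then show False using no p by blast
  qed
  let ?W = "wedge f g X Y"
  consider (none) "S \<inter> ?W = {}" | (one) s where "S \<inter> ?W = {s}"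
    | (two) s t where "S \<inter> ?W = {s, t}" "f s < f t"
  proof -
    have "card (S \<inter> ?W) \<le> 2"
    proof (rule ccontr)
      assume "\<not> card (S \<inter> ?W) \<le> 2"
      then have "3 \<le> card (S \<inter> ?W)" by simp
      then obtain T where "T \<subseteq> S \<inter> ?W" "card T = 3" by (metis obtain_subset_with_card_n)
      then obtain a b c where "T = {a,b,c}" "a \<noteq> b" "a \<noteq> c" "b \<noteq> c" by (metis card_3_iff)
      then show False using three_stairs[of a X Y b c] noedge \<open>T \<subseteq> _\<close> by auto
    qed
    then consider "card (S \<inter> ?W) = 0" | "card (S \<inter> ?W) = 1" | "card (S \<inter> ?W) = 2" by linarith
    then show thesis
    proof cases
      case 1 then show ?thesis using none finS by auto
    next
      case 2 then show ?thesis using one by (auto simp: card_1_singleton_iff)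
    next
      case 3
      then obtain s t where "S \<inter> ?W = {s,t}" "s \<noteq> t" by (auto simp: card_2_iff)
      moreover from this have "f s \<noteq> f t" using incomparable_eq[OF stairs_incomparable, of s t] by auto
      ultimately show ?thesis using two[of s t] two[of t s] by (metis insert_commute linorder_neqE_linordered_idom)
    qed
  qed
  then show ?thesis
  proof cases
    case none
    then have "P \<inter> ?W \<subseteq> B \<inter> ?W" using PW by auto
    then have "card (P \<inter> ?W) \<le> card (B \<inter> ?W)" using finB by (intro card_mono) auto
    also have "\<dots> \<le> 3" by (rule small, blast, use none in \<open>fastforce simp: wedge_def\<close>)
    finally show ?thesis by simp
  next
    case one
    let ?L = "{b \<in> B \<inter> ?W. f b < f s}" and ?R = "{b \<in> B \<inter> ?W. g b < g s}"
    have only: "z = s" if "z \<in> S" "f z \<le> X" "g z \<le> Y" for z using one that by (auto simp: wedge_def)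
    have "s \<in> S" using one by auto
    have sub: "P \<inter> ?W \<subseteq> {s} \<union> ?L \<union> ?R"
    proof
      fix q assume q: "q \<in> P \<inter> ?W"
      show "q \<in> {s} \<union> ?L \<union> ?R"
      proof (cases "q \<in> S")
        case True then show ?thesis using q one by blast
      next
        case False
        then have "q \<in> B" using PW q by blast
        then show ?thesis using stair_not_le_below[OF \<open>s \<in> S\<close>, of q] q by (auto simp: wedge_def)
      qed
    qed
    have "card ?L \<le> 3" "card ?R \<le> 3"
      by (rule small, blast, use only in \<open>fastforce simp: wedge_def\<close>)+
    moreover have "card (P \<inter> ?W) \<le> card ({s} \<union> ?L \<union> ?R)" using sub finB by (intro card_mono) auto
    moreover have "card ({s} \<union> ?L \<union> ?R) \<le> 1 + card ?L + card ?R"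
      using card_Un_le[of "{s} \<union> ?L" ?R] card_Un_le[of "{s}" ?L] by simp
    ultimately show ?thesis by linarith
  next
    case two
    \<comment> \<open>The pieces are left of \<open>s\<close>, below \<open>s\<close> and left of
      \<open>t\<close>, and below \<open>t\<close>. They may overlap, since only a union bound is
      used. A quadrant spanned by points of one piece lies in \<open>?W\<close> and misses both
      \<open>s\<close> and \<open>t\<close>.\<close>
    let ?L = "{b \<in> B \<inter> ?W. f b < f s}" and ?M = "{b \<in> B \<inter> ?W. g b < g s \<and> f b < f t}"
      and ?R = "{b \<in> B \<inter> ?W. g b < g t}"
    have only: "z = s \<or> z = t" if "z \<in> S" "f z \<le> X" "g z \<le> Y" for z using two that by (auto simp: wedge_def)
    have st: "s \<in> S" "t \<in> S" using two by auto
    have gt: "g t < g s" using incomparable_iff[OF stairs_incomparable st] two by simp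
    have sub: "P \<inter> ?W \<subseteq> {s, t} \<union> ?L \<union> ?M \<union> ?R"
    proof
      fix q assume q: "q \<in> P \<inter> ?W"
      show "q \<in> {s, t} \<union> ?L \<union> ?M \<union> ?R"
      proof (cases "q \<in> S")
        case True then show ?thesis using q two by blast
      next
        case False
        then have "q \<in> B" using PW q by blast
        then show ?thesis using stair_not_le_below[OF st(1), of q] stair_not_le_below[OF st(2), of q] q by (auto simp: wedge_def)
      qed
    qed
    moreover have "card ?L \<le> 3" "card ?M \<le> 3" "card ?R \<le> 3"
      by (rule small, blast, use only two(2) gt in \<open>fastforce simp: wedge_def\<close>)+
    moreover have "card (P \<inter> ?W) \<le> card ({s, t} \<union> ?L \<union> ?M \<union> ?R)" using sub finB by (intro card_mono) auto
    moreover have "card {s, t} \<le> 2" by (simp add: card_insert_if)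
    moreover have "card ({s, t} \<union> ?L \<union> ?M \<union> ?R) \<le> card {s, t} + card ?L + card ?M + card ?R"
      using card_Un_le[of "{s,t} \<union> ?L \<union> ?M" ?R] card_Un_le[of "{s,t} \<union> ?L" ?M] card_Un_le[of "{s,t}" ?L] by linarith
    ultimately show ?thesis by linarith
  qed
qed

section \<open>From quadrants over time to octants\<close>

text \<open>Points are inserted by increasing \<open>h\<close>, saturating after each arrival. An
  octant with bound \<open>Z\<close> is a quadrant on the points that have arrived by time
  \<open>Z\<close>, and an edge found there is never removed.\<close>

lemma octant_two_colouring:
  fixes f g h :: "'a \<Rightarrow> real"
  assumes "finite P"
  shows "\<exists>\<kappa>::'a \<Rightarrow> bool. \<forall>X Y Z. 12 \<le> card {q \<in> P. f q \<le> X \<and> g q \<le> Y \<and> h q \<le> Z} \<longrightarrow>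
     (\<exists>u v. u \<in> {q \<in> P. f q \<le> X \<and> g q \<le> Y \<and> h q \<le> Z} \<and>
       v \<in> {q \<in> P. f q \<le> X \<and> g q \<le> Y \<and> h q \<le> Z} \<and> \<kappa> u \<noteq> \<kappa> v)"
proof -
  define oct where "oct P X Y Z = {q \<in> P. h q \<le> Z} \<inter> wedge f g X Y" for P X Y Z
  have "\<exists>E S B. staircase f g P E S B \<and>
      (\<forall>X Y Z. 12 \<le> card (oct P X Y Z) \<longrightarrow> has_edge E (oct P X Y Z))"
    using assms
  proof (induction P rule: finite_ranking_induct[where f = h])
    case empty
    have "staircase f g {} {} {} {}" by unfold_locales (auto simp: incomparable_def)
    then show ?case by (intro exI[of _ "{}"]) (auto simp: oct_def)
  next
    case (insert x P)
    obtain E S B where st: "staircase f g P E S B"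
      and old: "\<And>X Y Z. 12 \<le> card (oct P X Y Z) \<Longrightarrow> has_edge E (oct P X Y Z)"
      using insert.IH by blast
    show ?case
    proof (cases "x \<in> P")
      case True
      then show ?thesis using st old by (auto simp: insert_absorb)
    next
      case False
      obtain E1 S1 B1 where 1: "E \<subseteq> E1" "staircase f g (insert x P) E1 S1 B1"
        using staircase.insert[OF st False] by blast
      obtain E2 S2 B2 where 2: "E1 \<subseteq> E2" "staircase f g (insert x P) E2 S2 B2" "saturated f g S2 B2"
        using staircase_saturate[OF 1(2)] by blast
      have "has_edge E2 (oct (insert x P) X Y Z)" if c: "12 \<le> card (oct (insert x P) X Y Z)" for X Y Z
      proof (cases "h x \<le> Z")
        case True
        \<comment> \<open>The newcomer has maximal \<open>h\<close>, so an octant that reaches it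
          imposes no bound on \<open>h\<close> for the points present.\<close>
        then have eq: "oct (insert x P) X Y Z = insert x P \<inter> wedge f g X Y"
          using insert.hyps by (force simp: oct_def)
        have "E2 \<subseteq> insert x P \<times> insert x P" using 2(2) by (rule staircase.edges_subset)
        moreover have "has_edge E2 (wedge f g X Y)"
          using staircase.wedge_bound[OF 2(2,3), of X Y] c eq by fastforce
        ultimately show ?thesis unfolding eq has_edge_def by blast
      next
        case False
        then have eq: "oct (insert x P) X Y Z = oct P X Y Z" by (auto simp: oct_def)
        show ?thesis using old[of X Y Z] c 1(1) 2(1) unfolding eq
          by (meson has_edge_mono order_refl subset_trans)
      qed
      then show ?thesis using 2(2) by blast
    qed
  qed
  then obtain E S B where st: "staircase f g P E S B"
      and edge: "\<And>X Y Z. 12 \<le> card (oct P X Y Z) \<Longrightarrow> has_edge E (oct P X Y Z)" by blast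
  obtain \<kappa> :: "'a \<Rightarrow> bool" where \<kappa>: "\<forall>(u, v)\<in>E. \<kappa> u \<noteq> \<kappa> v"
    using staircase.colouring_extends[OF st] by blast
  have "\<exists>u v. u \<in> oct P X Y Z \<and> v \<in> oct P X Y Z \<and> \<kappa> u \<noteq> \<kappa> v"
    if c: "12 \<le> card (oct P X Y Z)" for X Y Z
    using edge[OF c] \<kappa> unfolding has_edge_def by blast
  moreover have "oct P X Y Z = {q \<in> P. f q \<le> X \<and> g q \<le> Y \<and> h q \<le> Z}" for X Y Z
    by (auto simp: oct_def wedge_def)
  ultimately show ?thesis by (intro exI[of _ \<kappa>]) simp
qed

text \<open>
  The closure condition on \<open>Q\<close> covers octants given by strict as well as by weak inequalities,
  i.e. open as well as closed triangles.
\<close>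

lemma octant_closed_two_colouring:
  fixes f g h :: "'a \<Rightarrow> real"
  assumes fin: "finite P"
  shows "\<exists>\<kappa>::'a \<Rightarrow> bool. \<forall>Q\<subseteq>P. 12 \<le> card Q \<longrightarrow>
    (\<forall>r\<in>P. \<forall>a\<in>Q. \<forall>b\<in>Q. \<forall>c\<in>Q. f r \<le> f a \<and> g r \<le> g b \<and> h r \<le> h c \<longrightarrow> r \<in> Q) \<longrightarrow>
    (\<exists>u\<in>Q. \<exists>v\<in>Q. \<kappa> u \<noteq> \<kappa> v)"
proof -
  obtain \<kappa> :: "'a \<Rightarrow> bool" where \<kappa>: "\<And>X Y Z. 12 \<le> card {q \<in> P. f q \<le> X \<and> g q \<le> Y \<and> h q \<le> Z} \<Longrightarrow>
     \<exists>u v. u \<in> {q \<in> P. f q \<le> X \<and> g q \<le> Y \<and> h q \<le> Z} \<and>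
       v \<in> {q \<in> P. f q \<le> X \<and> g q \<le> Y \<and> h q \<le> Z} \<and> \<kappa> u \<noteq> \<kappa> v"
    using octant_two_colouring[OF fin, of f g h] by blast
  have "\<exists>u\<in>Q. \<exists>v\<in>Q. \<kappa> u \<noteq> \<kappa> v"
    if Q: "Q \<subseteq> P" "12 \<le> card Q"
      and closed: "\<forall>r\<in>P. \<forall>a\<in>Q. \<forall>b\<in>Q. \<forall>c\<in>Q. f r \<le> f a \<and> g r \<le> g b \<and> h r \<le> h c \<longrightarrow> r \<in> Q" for Q
  proof -
    have finQ: "finite Q" and ne: "Q \<noteq> {}" using Q fin finite_subset by auto
    have top: "\<exists>a\<in>Q. \<forall>q\<in>Q. k q \<le> k a" for k :: "'a \<Rightarrow> real"
      using Max_in[of "k ` Q"] Max_ge[of "k ` Q"] finQ ne by fastforce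
    obtain a b c where "a \<in> Q" "b \<in> Q" "c \<in> Q" and
      "\<forall>q\<in>Q. f q \<le> f a" "\<forall>q\<in>Q. g q \<le> g b" "\<forall>q\<in>Q. h q \<le> h c"
      using top[of f] top[of g] top[of h] by blast
    \<comment> \<open>The octant bounded by the coordinatewise maxima of \<open>Q\<close> contains
      \<open>Q\<close>, and by closure nothing else of \<open>P\<close>.\<close>
    then have "{q \<in> P. f q \<le> f a \<and> g q \<le> g b \<and> h q \<le> h c} = Q"
      using closed Q(1) by blast
    then show ?thesis using \<kappa>[of "f a" "g b" "h c"] Q(2) by auto
  qed
  then show ?thesis by blast
qed

section \<open>Compactness of the space of colourings\<close>

text \<open>By Tychonoff the product of two-point discrete spaces is compact. The colourings that
  are good at \<open>x\<close> form a closed set, and \<open>loc\<close> gives these sets the finite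
  intersection property.\<close>

lemma two_colouring_compactness:
  fixes N :: "'x \<Rightarrow> 'i set"
  assumes fin: "\<And>x. finite (N x)"
    and loc: "\<And>F. finite F \<Longrightarrow> \<exists>\<kappa>::'i \<Rightarrow> bool. \<forall>x\<in>F. \<exists>u\<in>N x. \<exists>v\<in>N x. \<kappa> u \<noteq> \<kappa> v"
  shows "\<exists>\<kappa>::'i \<Rightarrow> bool. \<forall>x. \<exists>u\<in>N x. \<exists>v\<in>N x. \<kappa> u \<noteq> \<kappa> v"
proof -
  define X :: "('i \<Rightarrow> bool) topology" where "X = product_topology (\<lambda>_. discrete_topology UNIV) UNIV"
  define C where "C x = {\<kappa>::'i \<Rightarrow> bool. \<exists>u\<in>N x. \<exists>v\<in>N x. \<kappa> u \<noteq> \<kappa> v}" for x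
  have top: "topspace X = UNIV" by (simp add: X_def)
  have "compact_space X"
    unfolding X_def compact_space_product_topology by (simp add: compact_space_discrete_topology)
  have coord: "closedin X {\<kappa>. \<kappa> u = t}" for u t
    using closedin_continuous_map_preimage[OF continuous_map_product_projection, of u UNIV "\<lambda>_. discrete_topology UNIV" "{t}"]
      top by (simp add: X_def)
  \<comment> \<open>Finiteness of \<open>N x\<close> makes this a finite union of closed conditions
    on two coordinates.\<close>
  have "C x = (\<Union>u\<in>N x. \<Union>v\<in>N x. \<Union>t\<in>UNIV. {\<kappa>. \<kappa> u = t} \<inter> {\<kappa>. \<kappa> v = (\<not> t)})" for x
    by (auto simp: C_def)
  then have closed: "closedin X (C x)" for x
    using fin by (auto intro!: closedin_Union closedin_Int coord)
  have "\<Inter>\<F> \<noteq> {}" if F: "finite \<F>" "\<F> \<subseteq> range C" for \<F>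
  proof -
    obtain F where "finite F" "\<F> = C ` F" using finite_subset_image[OF F] by blast
    moreover obtain \<kappa> :: "'i \<Rightarrow> bool" where "\<forall>x\<in>F. \<exists>u\<in>N x. \<exists>v\<in>N x. \<kappa> u \<noteq> \<kappa> v"
      using loc[OF \<open>finite F\<close>] ..
    then have "\<kappa> \<in> \<Inter>(C ` F)" by (simp add: C_def)
    ultimately show ?thesis by auto
  qed
  moreover have "(\<forall>K\<in>range C. closedin X K) \<and> (\<forall>\<F>. finite \<F> \<and> \<F> \<subseteq> range C \<longrightarrow> \<Inter>\<F> \<noteq> {})
      \<longrightarrow> \<Inter>(range C) \<noteq> {}"
    using \<open>compact_space X\<close> unfolding compact_space_fip by (rule spec)
  ultimately have "\<Inter>(range C) \<noteq> {}"
    using closed by simp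
  then obtain \<kappa> where "\<kappa> \<in> \<Inter>(range C)" by blast
  then show ?thesis by (intro exI[of _ \<kappa>]) (simp add: C_def)
qed

section \<open>Triangles as intersections of three half-planes\<close>

text \<open>\<open>b - a\<close> and \<open>c - a\<close> form a basis of the plane, so the
  barycentric weights of \<open>b\<close> and \<open>c\<close> are linear functions of
  \<open>x - a\<close>.\<close>

lemma triangle_barycentric:
  fixes a b c :: "real^2"
  assumes "\<not> collinear {a, b, c}"
  obtains \<phi> \<psi> :: "real^2 \<Rightarrow> real" where "linear \<phi>" "linear \<psi>"
    "\<And>x u v w. u + v + w = 1 \<Longrightarrow>
       u *\<^sub>R a + v *\<^sub>R b + w *\<^sub>R c = x \<longleftrightarrow> v = \<phi> (x - a) \<and> w = \<psi> (x - a)"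
proof -
  \<comment> \<open>The determinant of \<open>b - a\<close> and \<open>c - a\<close>;
    \<open>\<phi>\<close> and \<open>\<psi>\<close> are then given by Cramer's rule.\<close>
  define d where "d = (b - a)$1 * (c - a)$2 - (b - a)$2 * (c - a)$1"
  have "d \<noteq> 0"
  proof
    assume d0: "d = 0"
    let ?x = "b - a" and ?y = "c - a"
    have "collinear {0, ?x, ?y}"
    proof (cases "?x = 0")
      case False
      then have "?x$1 \<noteq> 0 \<or> ?x$2 \<noteq> 0" by (auto simp: vec_eq_iff forall_2)
      then have "?y = (?y$1 / ?x$1) *\<^sub>R ?x \<or> ?y = (?y$2 / ?x$2) *\<^sub>R ?x"
        using d0 by (auto simp: vec_eq_iff forall_2 d_def field_simps)
      then show ?thesis unfolding collinear_lemma by blast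
    qed simp
    then have "collinear {b, a, c}" by (subst collinear_3) auto
    then show False using assms by (simp add: insert_commute)
  qed
  define \<phi> where "\<phi> x = (x$1 * (c - a)$2 - x$2 * (c - a)$1) / d" for x :: "real^2"
  define \<psi> where "\<psi> x = ((b - a)$1 * x$2 - (b - a)$2 * x$1) / d" for x :: "real^2"
  have lin: "linear \<phi>" "linear \<psi>"
    by (auto intro!: linearI simp: \<phi>_def \<psi>_def algebra_simps add_divide_distrib diff_divide_distrib)
  have vals: "\<phi> (b - a) = 1" "\<phi> (c - a) = 0" "\<psi> (b - a) = 0" "\<psi> (c - a) = 1"
    using \<open>d \<noteq> 0\<close> by (simp_all add: \<phi>_def \<psi>_def d_def)
  have expand: "x = \<phi> x *\<^sub>R (b - a) + \<psi> x *\<^sub>R (c - a)" for x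
  proof -
    \<comment> \<open>\<open>d\<close> stays folded until the denominators have cancelled; only then
      is it expanded.\<close>
    have "d * x$1 = d * (\<phi> x *\<^sub>R (b - a) + \<psi> x *\<^sub>R (c - a))$1"
      "d * x$2 = d * (\<phi> x *\<^sub>R (b - a) + \<psi> x *\<^sub>R (c - a))$2"
      using \<open>d \<noteq> 0\<close> by (simp_all add: \<phi>_def \<psi>_def distrib_left mult.assoc[symmetric]) (simp_all add: d_def algebra_simps)
    then show ?thesis using \<open>d \<noteq> 0\<close> by (simp add: vec_eq_iff forall_2)
  qed
  have "u *\<^sub>R a + v *\<^sub>R b + w *\<^sub>R c = x \<longleftrightarrow> v = \<phi> (x - a) \<and> w = \<psi> (x - a)"
    if "u + v + w = 1" for x u v w
  proof -
    have u: "u = 1 - v - w" using that by simp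
    have eq: "u *\<^sub>R a + v *\<^sub>R b + w *\<^sub>R c = x \<longleftrightarrow> x - a = v *\<^sub>R (b - a) + w *\<^sub>R (c - a)"
      unfolding u by (auto simp: algebra_simps)
    show ?thesis
    proof
      assume "u *\<^sub>R a + v *\<^sub>R b + w *\<^sub>R c = x"
      then have "x - a = v *\<^sub>R (b - a) + w *\<^sub>R (c - a)" using eq by simp
      then show "v = \<phi> (x - a) \<and> w = \<psi> (x - a)"
        using vals lin by (simp add: linear_add linear_cmul)
    next
      assume "v = \<phi> (x - a) \<and> w = \<psi> (x - a)"
      then show "u *\<^sub>R a + v *\<^sub>R b + w *\<^sub>R c = x" using eq expand[of "x - a"] by simp
    qed
  qed
  then show thesis using that[OF lin] by blast
qed

text \<open>The half-planes say that the three barycentric weights are nonnegative, or positive for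
  the interior. The relation \<open>R\<close> treats closed and open triangles together.\<close>

lemma triangle_halfplanes:
  assumes "is_triangle T"
  shows "\<exists>(R :: real \<Rightarrow> real \<Rightarrow> bool) (\<phi>1 :: real^2 \<Rightarrow> real) (\<phi>2 :: real^2 \<Rightarrow> real) (\<phi>3 :: real^2 \<Rightarrow> real) c1 c2 c3.
    (R = (\<le>) \<or> R = (<)) \<and> linear \<phi>1 \<and> linear \<phi>2 \<and> linear \<phi>3 \<and>
    T = {x. R c1 (\<phi>1 x) \<and> R c2 (\<phi>2 x) \<and> R c3 (\<phi>3 x)}"
proof -
  obtain a b c where nc: "\<not> collinear {a, b, c}"
    and T: "T = convex hull {a, b, c} \<or> T = interior (convex hull {a, b, c})"
    using assms unfolding is_triangle_def by blast
  have "\<exists>R. (R = (\<le>) \<or> R = (<)) \<and>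
      T = {x. \<exists>u v w. R 0 u \<and> R 0 v \<and> R 0 w \<and> u + v + w = 1 \<and> u *\<^sub>R a + v *\<^sub>R b + w *\<^sub>R c = (x :: real^2)}"
    using T
  proof
    assume "T = convex hull {a, b, c}"
    then show ?thesis by (intro exI[of _ "(\<le>)"]) (auto simp: convex_hull_3)
  next
    assume "T = interior (convex hull {a, b, c})"
    then show ?thesis by (intro exI[of _ "(<)"]) (simp add: interior_convex_hull_3_minimal[OF nc])
  qed
  then obtain R where R: "R = (\<le>) \<or> R = (<)" and TR:
    "T = {x. \<exists>u v w. R 0 u \<and> R 0 v \<and> R 0 w \<and> u + v + w = 1 \<and> u *\<^sub>R a + v *\<^sub>R b + w *\<^sub>R c = (x :: real^2)}"
    by blast
  obtain \<phi> \<psi> :: "real^2 \<Rightarrow> real" where lin: "linear \<phi>" "linear \<psi>" and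
    bary: "\<And>x u v w. u + v + w = 1 \<Longrightarrow>
       u *\<^sub>R a + v *\<^sub>R b + w *\<^sub>R c = x \<longleftrightarrow> v = \<phi> (x - a) \<and> w = \<psi> (x - a)"
    using triangle_barycentric[OF nc] by blast
  have "x \<in> T \<longleftrightarrow> R 0 (1 - \<phi> (x - a) - \<psi> (x - a)) \<and> R 0 (\<phi> (x - a)) \<and> R 0 (\<psi> (x - a))" for x
  proof
    assume "x \<in> T"
    then obtain u v w where uvw: "R 0 u" "R 0 v" "R 0 w" "u + v + w = 1" "u *\<^sub>R a + v *\<^sub>R b + w *\<^sub>R c = x"
      using TR by blast
    then have "v = \<phi> (x - a)" "w = \<psi> (x - a)" using bary by blast+
    moreover from this have "u = 1 - \<phi> (x - a) - \<psi> (x - a)" using uvw(4) by simp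
    ultimately show "R 0 (1 - \<phi> (x - a) - \<psi> (x - a)) \<and> R 0 (\<phi> (x - a)) \<and> R 0 (\<psi> (x - a))"
      using uvw by simp
  next
    assume "R 0 (1 - \<phi> (x - a) - \<psi> (x - a)) \<and> R 0 (\<phi> (x - a)) \<and> R 0 (\<psi> (x - a))"
    moreover have "(1 - \<phi> (x - a) - \<psi> (x - a)) *\<^sub>R a + \<phi> (x - a) *\<^sub>R b + \<psi> (x - a) *\<^sub>R c = x"
      by (subst bary) auto
    ultimately show "x \<in> T" unfolding TR by fastforce
  qed
  \<comment> \<open>Linearity moves everything that depends on \<open>a\<close> to the left, leaving
    a constant bound on a linear form in \<open>x\<close>.\<close>
  moreover have "R 0 (1 - \<phi> (x - a) - \<psi> (x - a)) \<longleftrightarrow> R (- 1 - \<phi> a - \<psi> a) (- \<phi> x - \<psi> x)"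
    "R 0 (\<phi> (x - a)) \<longleftrightarrow> R (\<phi> a) (\<phi> x)" "R 0 (\<psi> (x - a)) \<longleftrightarrow> R (\<psi> a) (\<psi> x)" for x
    using R lin by (auto simp: linear_diff)
  ultimately have "x \<in> T \<longleftrightarrow> R (- 1 - \<phi> a - \<psi> a) (- \<phi> x - \<psi> x) \<and> R (\<phi> a) (\<phi> x) \<and> R (\<psi> a) (\<psi> x)" for x
    by simp
  then have "T = {x. R (- 1 - \<phi> a - \<psi> a) (- \<phi> x - \<psi> x) \<and> R (\<phi> a) (\<phi> x) \<and> R (\<psi> a) (\<psi> x)}"
    by blast
  moreover have "linear (\<lambda>x. - \<phi> x - \<psi> x)"
    using lin by (intro linear_compose_sub linear_compose_neg)
  ultimately show ?thesis
    using R lin by (intro exI conjI)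
qed

text \<open>A homothetic copy has the same three linear forms as \<open>T\<close>, only with new
  bounds, which serve as its coordinates \<open>f\<close>, \<open>g\<close>, \<open>h\<close>. The
  copies through \<open>x\<close> are those whose three bounds lie below the values of the forms at
  \<open>x\<close>. Stating this as a closure property avoids mentioning \<open>R\<close>.\<close>

lemma homothetic_copies_as_octants:
  assumes T: "is_triangle T" and hom: "\<And>i. i \<in> I \<Longrightarrow> homothetic_copy T (P i)"
  shows "\<exists>(f :: 'i \<Rightarrow> real) (g :: 'i \<Rightarrow> real) (h :: 'i \<Rightarrow> real). \<forall>x. \<forall>r\<in>I. \<forall>a\<in>I. \<forall>b\<in>I. \<forall>c\<in>I.
    x \<in> P a \<and> x \<in> P b \<and> x \<in> P c \<and> f r \<le> f a \<and> g r \<le> g b \<and> h r \<le> h c \<longrightarrow> x \<in> P r"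
proof -
  from triangle_halfplanes[OF T] show ?thesis
  proof (elim exE conjE)
    fix R :: "real \<Rightarrow> real \<Rightarrow> bool" and \<phi>1 \<phi>2 \<phi>3 :: "real^2 \<Rightarrow> real" and c1 c2 c3
    assume R: "R = (\<le>) \<or> R = (<)" and lin: "linear \<phi>1" "linear \<phi>2" "linear \<phi>3"
      and TR: "T = {x. R c1 (\<phi>1 x) \<and> R c2 (\<phi>2 x) \<and> R c3 (\<phi>3 x)}"
    have "\<exists>l v. l > 0 \<and> P i = (\<lambda>x. l *\<^sub>R x + v) ` T" if "i \<in> I" for i
      using hom[OF that] unfolding homothetic_copy_def by blast
    then obtain l v where lv: "\<And>i. i \<in> I \<Longrightarrow> l i > 0 \<and> P i = (\<lambda>x. l i *\<^sub>R x + v i) ` T"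
      by metis
    have half: "R c (\<phi> ((1 / s) *\<^sub>R (x - t))) \<longleftrightarrow> R (s * c + \<phi> t) (\<phi> x)"
      if "s > 0" "linear \<phi>" for s c x t and \<phi> :: "real^2 \<Rightarrow> real"
      using R that by (auto simp: linear_cmul linear_diff field_simps)
    have mem: "x \<in> P i \<longleftrightarrow> R (l i * c1 + \<phi>1 (v i)) (\<phi>1 x) \<and> R (l i * c2 + \<phi>2 (v i)) (\<phi>2 x) \<and>
        R (l i * c3 + \<phi>3 (v i)) (\<phi>3 x)" if i: "i \<in> I" for i x
    proof -
      have pos: "l i > 0" and Pi: "P i = (\<lambda>x. l i *\<^sub>R x + v i) ` T" using lv[OF i] by auto
      have "x \<in> P i \<longleftrightarrow> (1 / l i) *\<^sub>R (x - v i) \<in> T"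
      proof
        assume "x \<in> P i" then show "(1 / l i) *\<^sub>R (x - v i) \<in> T" using pos Pi by auto
      next
        assume "(1 / l i) *\<^sub>R (x - v i) \<in> T"
        then show "x \<in> P i" unfolding Pi by (rule rev_image_eqI) (use pos in simp)
      qed
      then show ?thesis using half[OF pos lin(1)] half[OF pos lin(2)] half[OF pos lin(3)] TR by simp
    qed
    have trans: "R r y" if "R s y" "r \<le> s" for r s y using that R by auto
    \<comment> \<open>The first inequality for \<open>r\<close> follows from the one for
      \<open>a\<close>, the second from \<open>b\<close> and the third from
      \<open>c\<close>.\<close>
    show ?thesis
      by (rule exI[of _ "\<lambda>i. l i * c1 + \<phi>1 (v i)"], rule exI[of _ "\<lambda>i. l i * c2 + \<phi>2 (v i)"],
          rule exI[of _ "\<lambda>i. l i * c3 + \<phi>3 (v i)"])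
        (intro allI ballI impI, elim conjE, unfold mem, intro conjI; elim conjE; erule trans; assumption)
  qed
qed

section \<open>From finitely many points to the whole plane\<close>

theorem theorem3:
  fixes T :: "(real^2) set" and I :: "'i set" and P :: "'i \<Rightarrow> (real^2) set"
  assumes "is_triangle T"
    and "\<And>i. i \<in> I \<Longrightarrow> homothetic_copy T (P i)"
    and "locally_finite_family I P"
    and "fold_covering 12 I P UNIV"
  shows "\<exists>I1 I2. I1 \<union> I2 = I \<and> I1 \<inter> I2 = {} \<and>
           covering I1 P UNIV \<and> covering I2 P UNIV"
proof -
  have "\<exists>(f :: 'i \<Rightarrow> real) (g :: 'i \<Rightarrow> real) (h :: 'i \<Rightarrow> real). \<forall>x. \<forall>r\<in>I. \<forall>a\<in>I. \<forall>b\<in>I. \<forall>c\<in>I.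
    x \<in> P a \<and> x \<in> P b \<and> x \<in> P c \<and> f r \<le> f a \<and> g r \<le> g b \<and> h r \<le> h c \<longrightarrow> x \<in> P r"
    by (rule homothetic_copies_as_octants) (fact assms)+
  then obtain f g h :: "'i \<Rightarrow> real" where octant: "\<forall>x. \<forall>r\<in>I. \<forall>a\<in>I. \<forall>b\<in>I. \<forall>c\<in>I.
    x \<in> P a \<and> x \<in> P b \<and> x \<in> P c \<and> f r \<le> f a \<and> g r \<le> g b \<and> h r \<le> h c \<longrightarrow> x \<in> P r"
    by (elim exE) (rule that)
  \<comment> \<open>The members through \<open>x\<close>: finitely many because \<open>{x}\<close>
    is compact, at least twelve by the covering hypothesis.\<close>
  define N where "N x = {i \<in> I. x \<in> P i}" for x
  have fin: "finite (N x)" for x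
    using assms(3) unfolding locally_finite_family_def N_def by (auto dest!: spec[of _ "{x}"])
  have many: "12 \<le> card (N x)" for x
  proof -
    obtain J where "J \<subseteq> I" "finite J" "card J = 12" "\<forall>i\<in>J. x \<in> P i"
      using assms(4) unfolding fold_covering_def by blast
    moreover from this have "J \<subseteq> N x" by (auto simp: N_def)
    ultimately show ?thesis using card_mono[OF fin] by metis
  qed
  have "\<exists>\<kappa>::'i \<Rightarrow> bool. \<forall>x\<in>F. \<exists>u\<in>N x. \<exists>v\<in>N x. \<kappa> u \<noteq> \<kappa> v" if "finite F" for F
  proof -
    \<comment> \<open>For finitely many points of the plane only finitely many indices matter, and
      each \<open>N x\<close> is closed in the octant sense by \<open>octant\<close>.\<close>
    have "finite (\<Union>x\<in>F. N x)" using that fin by blast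
    from octant_closed_two_colouring[OF this, of f g h]
    obtain \<kappa> :: "'i \<Rightarrow> bool" where \<kappa>: "\<forall>Q\<subseteq>(\<Union>x\<in>F. N x). 12 \<le> card Q \<longrightarrow>
      (\<forall>r\<in>(\<Union>x\<in>F. N x). \<forall>a\<in>Q. \<forall>b\<in>Q. \<forall>c\<in>Q. f r \<le> f a \<and> g r \<le> g b \<and> h r \<le> h c \<longrightarrow> r \<in> Q) \<longrightarrow>
      (\<exists>u\<in>Q. \<exists>v\<in>Q. \<kappa> u \<noteq> \<kappa> v)"
      by (elim exE) (rule that)
    have "\<exists>u\<in>N x. \<exists>v\<in>N x. \<kappa> u \<noteq> \<kappa> v" if "x \<in> F" for x
    proof (rule \<kappa>[rule_format, OF _ many])
      show "N x \<subseteq> (\<Union>x\<in>F. N x)" using that by blast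
      show "r \<in> N x" if "r \<in> (\<Union>x\<in>F. N x)" "a \<in> N x" "b \<in> N x" "c \<in> N x"
        "f r \<le> f a \<and> g r \<le> g b \<and> h r \<le> h c" for r a b c
      proof -
        have "r \<in> I" "a \<in> I" "b \<in> I" "c \<in> I" "x \<in> P a \<and> x \<in> P b \<and> x \<in> P c \<and> f r \<le> f a \<and> g r \<le> g b \<and> h r \<le> h c"
          using that by (auto simp: N_def)
        then have "x \<in> P r" by (rule octant[rule_format])
        then show ?thesis using \<open>r \<in> I\<close> by (simp add: N_def)
      qed
    qed
    then show ?thesis by blast
  qed
  from two_colouring_compactness[of N, OF fin this]
  obtain \<kappa> :: "'i \<Rightarrow> bool" where \<kappa>: "\<And>x. \<exists>u\<in>N x. \<exists>v\<in>N x. \<kappa> u \<noteq> \<kappa> v" by blast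
  \<comment> \<open>Since \<open>N x\<close> contains two colours, it contains each of the two truth
    values.\<close>
  have cover: "covering {i \<in> I. \<kappa> i = t} P UNIV" for t
    unfolding covering_def fold_covering_def
  proof
    fix x :: "real^2"
    obtain u where "u \<in> N x" "\<kappa> u = t" using \<kappa>[of x] by metis
    then show "\<exists>J\<subseteq>{i \<in> I. \<kappa> i = t}. finite J \<and> card J = 1 \<and> (\<forall>i\<in>J. x \<in> P i)"
      by (intro exI[of _ "{u}"]) (auto simp: N_def)
  qed
  have "{i \<in> I. \<kappa> i = True} \<union> {i \<in> I. \<kappa> i = False} = I"
    "{i \<in> I. \<kappa> i = True} \<inter> {i \<in> I. \<kappa> i = False} = {}" by auto
  with cover[of True] cover[of False] show ?thesis by blast
qed

end
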